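(* The expected number of edges of a DOAG drawn uniformly at random among all DOAGs with $n$ vertices is $\binom{n}{2} - O(n)$ as $n \to \infty$.
   Context: A directed ordered acyclic graph (DOAG) is a tuple $(V, E, (\prec_v)_{v \in V \cup \{\emptyset\}})$ where $V$ is a finite set of vertices, $E \subseteq V \times V$ is a set of edges such that $(V,E)$ is acyclic, for each $v \in V$, $\prec_v$ is a total order on the outgoing edges of $v$, and $\prec_\emptyset$ is a total order on the sources (vertices with no incoming edge). Two DOAGs are equal if there is a bijection of vertex sets preserving edges and all orders. The uniform distribution is over the finitely many (equivalence classes of) DOAGs with $n$ vertices, any number of edges and sources. *)

theory Defs
  imports "HOL-Probability.Probability" "HOL-Library.Landau_Symbols"
begin

text \<open>
  Orders are strict and are relations on exactly the set they order. The field \<open>out_order\<close>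
  represents the family indexed by the vertices, so it is required to be empty off \<open>verts\<close>;
  \<open>source_order\<close> is the component indexed by the empty-set symbol.
\<close>

record 'v doag =
  verts :: "'v set"
  edges :: "('v \<times> 'v) set"
  out_order :: "'v \<Rightarrow> (('v \<times> 'v) \<times> ('v \<times> 'v)) set"
  source_order :: "('v \<times> 'v) set"

definition out_edges :: "'v doag \<Rightarrow> 'v \<Rightarrow> ('v \<times> 'v) set" where
  "out_edges G v = {e \<in> edges G. fst e = v}"

definition sources :: "'v doag \<Rightarrow> 'v set" where
  "sources G = {v \<in> verts G. \<nexists>u. (u, v) \<in> edges G}"

definition total_ordering :: "'a set \<Rightarrow> ('a \<times> 'a) set \<Rightarrow> bool" where
  "total_ordering A r \<longleftrightarrow> r \<subseteq> A \<times> A \<and> strict_linear_order_on A r"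

definition is_doag :: "'v doag \<Rightarrow> bool" where
  "is_doag G \<longleftrightarrow>
     finite (verts G) \<and>
     edges G \<subseteq> verts G \<times> verts G \<and>
     acyclic (edges G) \<and>
     (\<forall>v \<in> verts G. total_ordering (out_edges G v) (out_order G v)) \<and>
     (\<forall>v. v \<notin> verts G \<longrightarrow> out_order G v = {}) \<and>
     total_ordering (sources G) (source_order G)"

definition doag_iso :: "('v \<Rightarrow> 'w) \<Rightarrow> 'v doag \<Rightarrow> 'w doag \<Rightarrow> bool" where
  "doag_iso f G H \<longleftrightarrow>
     bij_betw f (verts G) (verts H) \<and>
     (\<forall>u \<in> verts G. \<forall>v \<in> verts G. (u, v) \<in> edges G \<longleftrightarrow> (f u, f v) \<in> edges H) \<and>
     (\<forall>v \<in> verts G. \<forall>d \<in> out_edges G v. \<forall>e \<in> out_edges G v.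
        (d, e) \<in> out_order G v \<longleftrightarrow> (map_prod f f d, map_prod f f e) \<in> out_order H (f v)) \<and>
     (\<forall>u \<in> sources G. \<forall>v \<in> sources G.
        (u, v) \<in> source_order G \<longleftrightarrow> (f u, f v) \<in> source_order H)"

text \<open>
  Every DOAG on \<open>n\<close> vertices is isomorphic to one whose vertices are natural numbers, so the
  isomorphism classes of the following set are all the DOAGs with \<open>n\<close> vertices up to equality.
\<close>

definition doags_on :: "nat \<Rightarrow> nat doag set" where
  "doags_on n = {G. is_doag G \<and> card (verts G) = n}"

definition doag_equality :: "nat \<Rightarrow> (nat doag \<times> nat doag) set" where
  "doag_equality n = {(G, H). G \<in> doags_on n \<and> H \<in> doags_on n \<and> (\<exists>f. doag_iso f G H)}"

definition doag_classes :: "nat \<Rightarrow> nat doag set set" where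
  "doag_classes n = doags_on n // doag_equality n"

text \<open>The number of edges is constant on each class, see \<open>doag_iso_card_edges\<close>.\<close>

definition class_edge_count :: "nat doag set \<Rightarrow> nat" where
  "class_edge_count C = the_elem ((\<lambda>G. card (edges G)) ` C)"

definition expected_edges :: "nat \<Rightarrow> real" where
  "expected_edges n =
     measure_pmf.expectation (pmf_of_set (doag_classes n)) (\<lambda>C. real (class_edge_count C))"

lemma doag_iso_edges:
  assumes "is_doag G" "is_doag H" "doag_iso f G H"
  shows "edges H = map_prod f f ` edges G"
proof
  have b: "f ` verts G = verts H" using assms(3) by (simp add: doag_iso_def bij_betw_def)
  show "edges H \<subseteq> map_prod f f ` edges G"
  proof
    fix e assume e: "e \<in> edges H"
    obtain x y where xy: "e = (x, y)" by force
    have "x \<in> verts H" "y \<in> verts H" using e xy assms(2) by (auto simp: is_doag_def)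
    then obtain u v where "u \<in> verts G" "v \<in> verts G" "x = f u" "y = f v" using b by blast
    then show "e \<in> map_prod f f ` edges G"
      using e xy assms(3) by (force simp: doag_iso_def)
  qed
  show "map_prod f f ` edges G \<subseteq> edges H"
    using assms(1,3) by (fastforce simp: doag_iso_def is_doag_def)
qed

lemma doag_iso_card_edges:
  assumes "is_doag G" "is_doag H" "doag_iso f G H"
  shows "card (edges H) = card (edges G)"
proof -
  have "inj_on f (verts G)" using assms(3) by (simp add: doag_iso_def bij_betw_def)
  then have "inj_on (map_prod f f) (verts G \<times> verts G)" by (rule map_prod_inj_on) fact
  then have "inj_on (map_prod f f) (edges G)"
    by (rule inj_on_subset) (use assms(1) in \<open>simp add: is_doag_def\<close>)
  then show ?thesis using doag_iso_edges[OF assms] by (simp add: card_image)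
qed

lemma doag_iso_out_edges:
  assumes "is_doag G" "is_doag H" "doag_iso f G H" "v \<in> verts G"
  shows "out_edges H (f v) = map_prod f f ` out_edges G v"
proof -
  have i: "inj_on f (verts G)" using assms(3) by (simp add: doag_iso_def bij_betw_def)
  have "edges G \<subseteq> verts G \<times> verts G" using assms(1) by (simp add: is_doag_def)
  then have "f (fst e) = f v \<longleftrightarrow> fst e = v" if "e \<in> edges G" for e
    using that inj_on_eq_iff[OF i _ assms(4)] by fastforce
  then show ?thesis
    unfolding out_edges_def doag_iso_edges[OF assms(1-3)] by auto
qed

lemma doag_iso_sources:
  assumes "is_doag G" "is_doag H" "doag_iso f G H"
  shows "sources H = f ` sources G"
proof -
  have i: "inj_on f (verts G)" and b: "verts H = f ` verts G"
    using assms(3) by (simp_all add: doag_iso_def bij_betw_def)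
  have E: "edges G \<subseteq> verts G \<times> verts G" using assms(1) by (simp add: is_doag_def)
  have "(\<exists>u. (u, f v) \<in> edges H) \<longleftrightarrow> (\<exists>u. (u, v) \<in> edges G)"
    if v: "v \<in> verts G" for v
  proof
    assume "\<exists>u. (u, f v) \<in> edges H"
    then obtain x y where xy: "(x, y) \<in> edges G" "f y = f v"
      unfolding doag_iso_edges[OF assms] by auto
    then have "y = v" using E inj_onD[OF i xy(2)] v by blast
    then show "\<exists>u. (u, v) \<in> edges G" using xy(1) by blast
  qed (force simp: doag_iso_edges[OF assms])
  then show ?thesis
    unfolding sources_def b by auto
qed

lemma doag_iso_refl: "doag_iso (\<lambda>x. x) G G"
  by (auto simp: doag_iso_def bij_betw_def map_prod_def)

lemma doag_iso_trans:
  assumes "is_doag G" "is_doag H" "doag_iso f G H" "doag_iso g H K"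
  shows "doag_iso (g \<circ> f) G K"
proof -
  have fv: "f v \<in> verts H" if "v \<in> verts G" for v
    using that assms(3) by (auto simp: doag_iso_def bij_betw_def)
  have fo: "map_prod f f e \<in> out_edges H (f v)" if "v \<in> verts G" "e \<in> out_edges G v" for v e
    using that doag_iso_out_edges[OF assms(1-3)] by blast
  have fs: "f v \<in> sources H" if "v \<in> sources G" for v
    using that doag_iso_sources[OF assms(1-3)] by blast
  have m: "map_prod (g \<circ> f) (g \<circ> f) e = map_prod g g (map_prod f f e)" for e
    by (cases e) simp
  show ?thesis
    unfolding doag_iso_def m
  proof (intro conjI ballI)
    show "bij_betw (g \<circ> f) (verts G) (verts K)"
      using assms(3,4) by (auto simp: doag_iso_def intro: bij_betw_trans)
  qed (use assms(3,4) fv fo fs in \<open>simp_all add: doag_iso_def\<close>)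
qed

lemma doag_iso_sym:
  assumes "is_doag G" "is_doag H" "doag_iso f G H"
  shows "doag_iso (inv_into (verts G) f) H G"
proof -
  let ?g = "inv_into (verts G) f"
  have bij: "bij_betw f (verts G) (verts H)" using assms(3) by (simp add: doag_iso_def)
  then have b: "verts H = f ` verts G" and gf: "\<And>v. v \<in> verts G \<Longrightarrow> ?g (f v) = v"
    by (auto simp: bij_betw_def)
  have E: "edges G \<subseteq> verts G \<times> verts G" using assms(1) by (simp add: is_doag_def)
  have gf2: "map_prod ?g ?g (map_prod f f e) = e" if "e \<in> out_edges G v" for e v
    using that E gf by (cases e) (auto simp: out_edges_def)
  have S: "sources G \<subseteq> verts G" by (auto simp: sources_def)
  show ?thesis
    unfolding doag_iso_def doag_iso_sources[OF assms]
  proof (intro conjI ballI)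
    show "bij_betw ?g (verts H) (verts G)" using bij by (rule bij_betw_inv_into)
  next
    fix u v assume "u \<in> verts H" "v \<in> verts H"
    then show "(u, v) \<in> edges H \<longleftrightarrow> (?g u, ?g v) \<in> edges G"
      using assms(3) gf by (auto simp: b doag_iso_def)
  next
    fix w d e assume "w \<in> verts H" "d \<in> out_edges H w" "e \<in> out_edges H w"
    then obtain v d' e' where v: "v \<in> verts G" "w = f v"
      and d: "d' \<in> out_edges G v" "d = map_prod f f d'"
      and e: "e' \<in> out_edges G v" "e = map_prod f f e'"
      using b doag_iso_out_edges[OF assms] by auto
    then show "(d, e) \<in> out_order H w \<longleftrightarrow>
        (map_prod ?g ?g d, map_prod ?g ?g e) \<in> out_order G (?g w)"
      using assms(3) gf[OF v(1)] gf2[OF d(1)] gf2[OF e(1)] by (simp add: doag_iso_def)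
  next
    fix u v assume "u \<in> f ` sources G" "v \<in> f ` sources G"
    then show "(u, v) \<in> source_order H \<longleftrightarrow> (?g u, ?g v) \<in> source_order G"
      using assms(3) gf S by (auto simp: doag_iso_def subset_iff)
  qed
qed

lemma equiv_doag_equality: "equiv (doags_on n) (doag_equality n)"
proof (rule equivI)
  show "doag_equality n \<subseteq> doags_on n \<times> doags_on n"
    by (auto simp: doag_equality_def)
  show "refl_on (doags_on n) (doag_equality n)"
    unfolding refl_on_def doag_equality_def using doag_iso_refl by blast
  show "sym (doag_equality n)"
    unfolding sym_def doag_equality_def doags_on_def using doag_iso_sym by blast
  show "trans (doag_equality n)"
    unfolding trans_def doag_equality_def doags_on_def using doag_iso_trans by blast
qed

end

theory Submission
  imports Defs "HOL-Combinatorics.Multiset_Permutations"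
begin

text \<open>
  Let \<open>M\<close> be the number of vertex pairs not joined by an edge; an exponential moment bound
  \<open>E (exp M) \<le> exp (e n)\<close> yields \<open>E M \<le> e n\<close> by Jensen. Upper bound for the sum of \<open>exp M\<close>:
  the relation made of the edges and the source order is acyclic, so every DOAG can be numbered
  increasingly along both; it is then determined by the ordered lists of out-edges, and
  the vertex with \<open>m\<close> possible successors contributes at most
  \<open>\<Sum>k\<le>m. m!/k! e^k \<le> m! exp e\<close>. Lower bound for the number of DOAGs: transitive tournaments are
  rigid, so their out-orders, arbitrary at each vertex, give \<open>\<Prod>m<n. m!\<close> different DOAGs.
  The factorials cancel.
\<close>

subsection \<open>Strict linear orders as distinct lists\<close>

text \<open>The pairs run from earlier to later entries. On a finite set, strict linear orders
  correspond in this way to the distinct lists of its elements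
  (\<open>total_ordering_list_order\<close>, \<open>list_order_inject\<close>,
  \<open>total_ordering_list\<close>), so orders can be counted as lists.\<close>

fun list_order :: "'a list \<Rightarrow> ('a \<times> 'a) set" where
  "list_order [] = {}"
| "list_order (x # xs) = {x} \<times> set xs \<union> list_order xs"

lemma list_order_subset: "list_order xs \<subseteq> set xs \<times> set xs"
  by (induction xs) auto

lemma total_ordering_list_order:
  assumes "distinct xs"
  shows "total_ordering (set xs) (list_order xs)"
  using assms
proof (induction xs)
  case Nil
  then show ?case
    by (simp add: total_ordering_def strict_linear_order_on_def trans_def irrefl_def)
next
  case (Cons x xs)
  then have "x \<notin> set xs" "trans (list_order xs)" "irrefl (list_order xs)"
      "total_on (set xs) (list_order xs)"
    by (auto simp: total_ordering_def strict_linear_order_on_def)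
  then have "trans (list_order (x # xs))" "irrefl (list_order (x # xs))"
      "total_on (set (x # xs)) (list_order (x # xs))"
    using list_order_subset[of xs] by (auto simp: trans_def irrefl_def total_on_def)
  then show ?case
    using list_order_subset[of "x # xs"]
    by (simp add: total_ordering_def strict_linear_order_on_def del: list_order.simps)
qed

text \<open>The head precedes everything else, so the heads agree; removing the pairs that start
  with it leaves the order of the tail. The sets have to be compared as well, since
  \<open>[]\<close> and every one-element list have the same empty order.\<close>

lemma list_order_inject:
  assumes "distinct xs" "distinct ys" "set xs = set ys" "list_order xs = list_order ys"
  shows "xs = ys"
  using assms
proof (induction xs arbitrary: ys)
  case Nil
  then show ?case by simp
next
  case (Cons x xs)
  obtain y ys' where ys: "ys = y # ys'" using Cons.prems(3) by (cases ys) simp_all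
  have "x = y"
  proof (rule ccontr)
    assume "x \<noteq> y"
    then have "y \<in> set xs" using Cons.prems(3) ys by auto
    then have "(x, y) \<in> list_order (y # ys')" using Cons.prems(4) ys by auto
    then have "y \<in> set ys'" using \<open>x \<noteq> y\<close> list_order_subset[of ys'] by auto
    then show False using Cons.prems(2) ys by simp
  qed
  have tail: "list_order zs = {p \<in> list_order (z # zs). fst p \<noteq> z}"
    if "z \<notin> set zs" for z and zs :: "'a list"
  proof -
    have "fst p \<noteq> z" if "p \<in> list_order zs" for p
      using subsetD[OF list_order_subset that] \<open>z \<notin> set zs\<close> by (metis mem_Times_iff)
    then show ?thesis by auto
  qed
  have notin: "x \<notin> set xs" "x \<notin> set ys'" using Cons.prems(1,2) ys \<open>x = y\<close> by simp_all
  have "list_order (x # xs) = list_order (x # ys')"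
    using Cons.prems(4) unfolding ys \<open>x = y\<close> .
  then have "list_order xs = list_order ys'"
    using tail[OF notin(1)] tail[OF notin(2)] by (simp only:)
  moreover have "set xs = set ys'"
    using notin Cons.prems(3) ys \<open>x = y\<close>
    by (simp add: insert_ident)
  ultimately have "xs = ys'" using Cons.IH Cons.prems(1,2) ys by simp
  then show ?case using ys \<open>x = y\<close> by simp
qed

lemma list_order_map: "list_order (map h xs) = map_prod h h ` list_order xs"
  by (induction xs) auto

lemma nth_in_list_order:
  assumes "i < j" "j < length xs"
  shows "(xs ! i, xs ! j) \<in> list_order xs"
  using assms
proof (induction xs arbitrary: i j)
  case (Cons x xs)
  then show ?case by (cases i; cases j) auto
qed simp

text \<open>Topological sorting: a minimal element of \<open>A\<close> becomes the head and the rest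
  is sorted recursively. The relation \<open>r\<close> may be infinite, so well-foundedness is only
  derived for its restriction to \<open>A\<close>.\<close>

lemma linear_extension_list:
  assumes "finite A" "acyclic r"
  shows "\<exists>xs. distinct xs \<and> set xs = A \<and> (\<forall>x y. (x, y) \<in> list_order xs \<longrightarrow> (y, x) \<notin> r)"
  using assms(1)
proof (induction A rule: finite_psubset_induct)
  case (psubset A)
  show ?case
  proof (cases "A = {}")
    case True
    then show ?thesis by (intro exI[of _ "[]"]) simp
  next
    case False
    have "wf (r \<inter> A \<times> A)"
      using psubset.hyps acyclic_subset[OF assms(2) Int_lower1] by (simp add: finite_acyclic_wf)
    moreover obtain a where "a \<in> A" using False by blast
    ultimately obtain m where m': "m \<in> A" "\<And>y. (y, m) \<in> r \<inter> A \<times> A \<Longrightarrow> y \<notin> A"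
      using wfE_min[of "r \<inter> A \<times> A" a A] by metis
    then have m: "m \<in> A" "\<And>y. y \<in> A \<Longrightarrow> (y, m) \<notin> r" by blast+
    obtain xs where "distinct xs" "set xs = A - {m}"
        "\<forall>x y. (x, y) \<in> list_order xs \<longrightarrow> (y, x) \<notin> r"
      using psubset.IH[of "A - {m}"] m(1) by auto
    then show ?thesis using m by (intro exI[of _ "m # xs"]) auto
  qed
qed

text \<open>The number of an element is its position in a topologically sorted list.\<close>

lemma linear_extension:
  assumes "finite A" "acyclic r"
  obtains f where "bij_betw f A {..<card A}"
    and "\<And>x y. x \<in> A \<Longrightarrow> y \<in> A \<Longrightarrow> (x, y) \<in> r \<Longrightarrow> f x < (f y :: nat)"
proof -
  obtain xs where xs: "distinct xs" "set xs = A"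
      "\<And>x y. (x, y) \<in> list_order xs \<Longrightarrow> (y, x) \<notin> r"
    using linear_extension_list[OF assms] by blast
  have len: "length xs = card A" using xs by (metis distinct_card)
  have b: "bij_betw ((!) xs) {..<card A} A"
    using xs len by (intro bij_betw_nth) auto
  define f where "f = inv_into {..<card A} ((!) xs)"
  have bf: "bij_betw f A {..<card A}"
    unfolding f_def using b by (rule bij_betw_inv_into)
  have nf: "xs ! f x = x" "f x < card A" if "x \<in> A" for x
    using that b bij_betwE[OF bf] by (simp_all add: f_def bij_betw_inv_into_right)
  have "f x < f y" if "x \<in> A" "y \<in> A" "(x, y) \<in> r" for x y
  proof (rule ccontr)
    assume "\<not> f x < f y"
    moreover have "f x \<noteq> f y"
      using that nf assms(2) by (metis acyclic_def r_into_trancl')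
    ultimately have "(y, x) \<in> list_order xs"
      using nth_in_list_order[of "f y" "f x" xs] nf that len by auto
    then show False using xs(3) that by blast
  qed
  then show ?thesis by (rule that[OF bf])
qed

text \<open>A linear extension of a total order is that order: both relations are total on
  \<open>A\<close> and neither reverses a pair of the other.\<close>

lemma total_ordering_list:
  assumes "finite A" "total_ordering A r"
  obtains xs where "distinct xs" "set xs = A" "list_order xs = r"
proof -
  have r: "r \<subseteq> A \<times> A" "trans r" "irrefl r" "total_on A r"
    using assms(2) by (auto simp: total_ordering_def strict_linear_order_on_def)
  then have "acyclic r" by (simp add: acyclic_irrefl)
  then obtain xs where xs: "distinct xs" "set xs = A"
      "\<And>x y. (x, y) \<in> list_order xs \<Longrightarrow> (y, x) \<notin> r"
    using linear_extension_list[OF assms(1)] by blast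
  have l: "list_order xs \<subseteq> A \<times> A" "irrefl (list_order xs)" "total_on A (list_order xs)"
    using total_ordering_list_order[OF xs(1)] xs(2)
    by (auto simp: total_ordering_def strict_linear_order_on_def)
  have "list_order xs = r"
  proof (intro equalityI subrelI)
    fix x y assume "(x, y) \<in> list_order xs"
    then have "x \<in> A" "y \<in> A" "x \<noteq> y" "(y, x) \<notin> r"
      using l xs(3) by (auto simp: irrefl_def)
    then show "(x, y) \<in> r"
      using r(4) by (auto simp: total_on_def)
  next
    fix x y assume "(x, y) \<in> r"
    then have "x \<in> A" "y \<in> A" "x \<noteq> y" "(y, x) \<notin> list_order xs"
      using r(1,3) xs(3) by (auto simp: irrefl_def)
    then show "(x, y) \<in> list_order xs"
      using l(3) by (auto simp: total_on_def)
  qed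
  then show ?thesis by (rule that[OF xs(1,2)])
qed

subsection \<open>Increasingly numbered DOAGs\<close>

text \<open>
  The numbering also induces the source order. Labelling along the edges alone would leave a factor
  of up to \<open>n!\<close> for the source order, too much for a linear bound.
\<close>

definition increasing_doag :: "nat \<Rightarrow> (nat \<Rightarrow> (nat \<times> nat) list) \<Rightarrow> nat doag" where
  "increasing_doag n l =
     (let E = (\<Union>i<n. set (l i)); S = {v. v < n \<and> (\<nexists>u. (u, v) \<in> E)} in
      \<lparr>verts = {..<n}, edges = E, out_order = (\<lambda>i. if i < n then list_order (l i) else {}),
       source_order = {(u, v). u \<in> S \<and> v \<in> S \<and> u < v}\<rparr>)"

text \<open>Extensional functions make this a finite product with one independent choice per vertex,
  so sums of products over it factor. All edges go from a smaller to a larger number.\<close>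

definition out_lists :: "nat \<Rightarrow> (nat \<Rightarrow> (nat \<times> nat) list) set" where
  "out_lists n = (\<Pi>\<^sub>E i\<in>{..<n}. {xs. distinct xs \<and> set xs \<subseteq> {i} \<times> {i<..<n}})"

text \<open>These describe the transitive tournament on \<open>n\<close> vertices with arbitrary
  out-orders.\<close>

definition full_out_lists :: "nat \<Rightarrow> (nat \<Rightarrow> (nat \<times> nat) list) set" where
  "full_out_lists n = (\<Pi>\<^sub>E i\<in>{..<n}. permutations_of_set ({i} \<times> {i<..<n}))"

lemma increasing_doag_simps [simp]:
  "verts (increasing_doag n l) = {..<n}"
  "edges (increasing_doag n l) = (\<Union>i<n. set (l i))"
  "out_order (increasing_doag n l) = (\<lambda>i. if i < n then list_order (l i) else {})"
  "source_order (increasing_doag n l) =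
     {(u, v). u \<in> sources (increasing_doag n l) \<and> v \<in> sources (increasing_doag n l) \<and> u < v}"
  by (auto simp: increasing_doag_def Let_def sources_def)

lemma out_listsD:
  assumes "l \<in> out_lists n" "i < n"
  shows "distinct (l i)" "set (l i) \<subseteq> {i} \<times> {i<..<n}"
  using assms by (auto simp: out_lists_def PiE_def Pi_def)

lemma out_edges_increasing_doag:
  assumes "l \<in> out_lists n" "i < n"
  shows "out_edges (increasing_doag n l) i = set (l i)"
proof -
  have "fst e = j" if "j < n" "e \<in> set (l j)" for e j
    using out_listsD(2)[OF assms(1) that(1)] that(2) by auto
  then show ?thesis using assms(2) by (auto simp: out_edges_def)
qed

lemma increasing_doag_in_doags_on:
  assumes "l \<in> out_lists n"
  shows "increasing_doag n l \<in> doags_on n"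
proof -
  let ?G = "increasing_doag n l"
  have E: "(\<Union>i<n. set (l i)) \<subseteq> {(u, v). u < v \<and> v < n}"
  proof
    fix e assume "e \<in> (\<Union>i<n. set (l i))"
    then obtain i where "i < n" "e \<in> set (l i)" by blast
    then show "e \<in> {(u, v). u < v \<and> v < n}"
      using out_listsD(2)[OF assms \<open>i < n\<close>] by auto
  qed
  have "acyclic (edges ?G)"
    by (rule acyclic_subset[OF wf_acyclic[OF wf_less]]) (use E in auto)
  moreover have "total_ordering (sources ?G) (source_order ?G)"
    by (auto simp: total_ordering_def strict_linear_order_on_def trans_def irrefl_def total_on_def)
  moreover have "edges ?G \<subseteq> verts ?G \<times> verts ?G" using E by auto
  moreover have "total_ordering (out_edges ?G v) (out_order ?G v)" if "v < n" for v
    using that out_edges_increasing_doag[OF assms that] out_listsD(1)[OF assms that]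
      total_ordering_list_order by simp
  ultimately show ?thesis
    by (simp add: doags_on_def is_doag_def del: increasing_doag_simps(2,4))
qed

text \<open>The isomorphism \<open>f\<close> numbers the vertices along a linear extension of the
  edges together with the source order. Edges then go upwards, the source order becomes
  \<open><\<close>, and the out-orders are carried over as lists.\<close>

lemma doag_iso_increasing_doag:
  assumes "G \<in> doags_on n"
  obtains l f where "l \<in> out_lists n" "doag_iso f G (increasing_doag n l)"
proof -
  have fin: "finite (verts G)" and E: "edges G \<subseteq> verts G \<times> verts G" and ac: "acyclic (edges G)"
    and oo: "\<And>v. v \<in> verts G \<Longrightarrow> total_ordering (out_edges G v) (out_order G v)"
    and so: "total_ordering (sources G) (source_order G)" and n: "card (verts G) = n"
    using assms by (auto simp: doags_on_def is_doag_def)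
  have S: "sources G \<subseteq> verts G" by (auto simp: sources_def)
  have finE: "finite (edges G)" using E fin by (meson finite_SigmaI finite_subset)
  have so': "source_order G \<subseteq> sources G \<times> sources G" "trans (source_order G)"
      "irrefl (source_order G)" "total_on (sources G) (source_order G)"
    using so by (auto simp: total_ordering_def strict_linear_order_on_def)
  \<comment> \<open>No edge ends at a source, so the composition of \<open>edges G\<close> with
    \<open>source_order G\<close> is empty and the union of the two well-founded relations is
    well-founded.\<close>
  have "acyclic (edges G \<union> source_order G)"
  proof (rule wf_acyclic, rule wf_union_compatible)
    show "wf (edges G)" using finE ac by (rule finite_acyclic_wf)
    have "finite (source_order G)"
      using so'(1) S fin by (meson finite_SigmaI finite_subset)
    then show "wf (source_order G)"
      using so'(2,3) by (intro finite_acyclic_wf) (auto simp: acyclic_irrefl)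
    show "edges G O source_order G \<subseteq> edges G"
      using so'(1) by (auto simp: sources_def)
  qed
  then obtain f where f: "bij_betw f (verts G) {..<n}"
    and less: "\<And>x y. x \<in> verts G \<Longrightarrow> y \<in> verts G \<Longrightarrow> (x, y) \<in> edges G \<union> source_order G \<Longrightarrow> f x < f y"
    using linear_extension[OF fin] n by metis
  have inj: "inj_on f (verts G)" and im: "f ` verts G = {..<n}"
    using f by (auto simp: bij_betw_def)
  define h where "h = map_prod f f"
  have injh: "inj_on h (verts G \<times> verts G)"
    unfolding h_def using inj inj by (rule map_prod_inj_on)
  have finO: "finite (out_edges G v)" for v
    using finE by (auto simp: out_edges_def)
  have OE: "out_edges G v \<subseteq> verts G \<times> verts G" for v
    using E by (auto simp: out_edges_def)
  have "\<exists>xs. distinct xs \<and> set xs = out_edges G v \<and> list_order xs = out_order G v"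
    if "v \<in> verts G" for v
    by (rule total_ordering_list[OF finO oo[OF that]]) blast
  then have "\<exists>k. \<forall>v\<in>verts G. distinct (k v) \<and> set (k v) = out_edges G v \<and>
      list_order (k v) = out_order G v"
    by (intro bchoice) blast
  then obtain k where k: "\<And>v. v \<in> verts G \<Longrightarrow> distinct (k v)"
      "\<And>v. v \<in> verts G \<Longrightarrow> set (k v) = out_edges G v"
      "\<And>v. v \<in> verts G \<Longrightarrow> list_order (k v) = out_order G v"
    by blast
  \<comment> \<open>The inverse of \<open>f\<close> recovers the vertex numbered \<open>i\<close>;
    the restriction to \<open>{..<n}\<close> supplies the extensionality required by
    \<open>out_lists\<close>.\<close>
  define l where "l = (\<lambda>i\<in>{..<n}. map h (k (inv_into (verts G) f i)))"
  have lf: "l (f v) = map h (k v)" if "v \<in> verts G" for v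
  proof -
    have "f v < n" using that im by blast
    then show ?thesis using that inj by (simp add: l_def)
  qed
  have fn: "f v < n" if "v \<in> verts G" for v
    using that im by blast
  have "l i \<in> {xs. distinct xs \<and> set xs \<subseteq> {i} \<times> {i<..<n}}" if "i < n" for i
  proof -
    have "i \<in> f ` verts G" using that im by simp
    then obtain v where v: "v \<in> verts G" "i = f v" by blast
    have "inj_on h (set (k v))"
      using inj_on_subset[OF injh OE] k(2)[OF v(1)] by simp
    then have "distinct (l i)" using lf[OF v(1)] v k(1)[OF v(1)] by (simp add: distinct_map)
    moreover have "h e \<in> {i} \<times> {i<..<n}" if "e \<in> out_edges G v" for e
    proof -
      obtain b where b: "e = (v, b)" "(v, b) \<in> edges G"
        using \<open>e \<in> out_edges G v\<close> by (cases e) (auto simp: out_edges_def)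
      then have "b \<in> verts G" using E by auto
      then have "f b < n" "f v < f b" using im less[OF v(1)] b(2) by blast+
      then show ?thesis using b(1) v(2) by (simp add: h_def)
    qed
    then have "h ` out_edges G v \<subseteq> {i} \<times> {i<..<n}" by (rule image_subsetI)
    ultimately show ?thesis
      using lf[OF v(1)] v(2) k(2)[OF v(1)] by simp
  qed
  then have l: "l \<in> out_lists n"
    unfolding out_lists_def by (intro PiE_I) (auto simp: l_def)
  have UN: "(\<Union>i<n. set (l i)) = h ` edges G"
  proof -
    have "(\<Union>i<n. set (l i)) = (\<Union>v\<in>verts G. set (l (f v)))"
      unfolding im[symmetric] by simp
    also have "\<dots> = (\<Union>v\<in>verts G. h ` out_edges G v)" using lf k(2) by simp
    also have "\<dots> = h ` (\<Union>v\<in>verts G. out_edges G v)" by blast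
    also have "(\<Union>v\<in>verts G. out_edges G v) = edges G" using E by (auto simp: out_edges_def)
    finally show ?thesis .
  qed
  have edge_iff: "(f u, f v) \<in> h ` edges G \<longleftrightarrow> (u, v) \<in> edges G"
    if "u \<in> verts G" "v \<in> verts G" for u v
    using inj_on_image_mem_iff[OF injh, of "(u, v)" "edges G"] that E by (simp add: h_def)
  have source_iff: "f v \<in> sources (increasing_doag n l) \<longleftrightarrow> v \<in> sources G" if v: "v \<in> verts G" for v
  proof -
    have "(\<exists>u. (u, f v) \<in> h ` edges G) \<longleftrightarrow> (\<exists>u. (u, v) \<in> edges G)"
    proof
      assume "\<exists>u. (u, f v) \<in> h ` edges G"
      then obtain a b where ab: "(a, b) \<in> edges G" "f b = f v" by (auto simp: h_def)
      then have "b = v" using E inj_onD[OF inj ab(2)] v by blast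
      then show "\<exists>u. (u, v) \<in> edges G" using ab(1) by blast
    next
      assume "\<exists>u. (u, v) \<in> edges G"
      then obtain u where "(u, v) \<in> edges G" by blast
      then have "(f u, f v) \<in> h ` edges G" by (force simp: h_def)
      then show "\<exists>u. (u, f v) \<in> h ` edges G" by blast
    qed
    then show ?thesis using v fn[OF v] by (simp add: sources_def UN) blast
  qed
  have "doag_iso f G (increasing_doag n l)"
    unfolding doag_iso_def
  proof (intro conjI ballI)
    show "bij_betw f (verts G) (verts (increasing_doag n l))" using f by simp
  next
    fix u v assume "u \<in> verts G" "v \<in> verts G"
    then show "(u, v) \<in> edges G \<longleftrightarrow> (f u, f v) \<in> edges (increasing_doag n l)"
      using edge_iff by (simp add: UN)
  next
    fix v d e assume v: "v \<in> verts G" and de: "d \<in> out_edges G v" "e \<in> out_edges G v"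
    have "out_order G v \<subseteq> out_edges G v \<times> out_edges G v"
      using oo[OF v] by (simp add: total_ordering_def)
    moreover have "inj_on (map_prod h h) (out_edges G v \<times> out_edges G v)"
      by (intro map_prod_inj_on inj_on_subset[OF injh] OE)
    ultimately have "(d, e) \<in> out_order G v \<longleftrightarrow> (h d, h e) \<in> map_prod h h ` out_order G v"
      using inj_on_image_mem_iff[of "map_prod h h" "out_edges G v \<times> out_edges G v" "(d, e)"] de
      by simp
    then show "(d, e) \<in> out_order G v \<longleftrightarrow>
        (map_prod f f d, map_prod f f e) \<in> out_order (increasing_doag n l) (f v)"
      using fn[OF v] lf[OF v] k(3)[OF v] by (simp add: list_order_map flip: h_def)
  next
    fix u v assume uv: "u \<in> sources G" "v \<in> sources G"
    \<comment> \<open>One direction is monotonicity of \<open>f\<close>. Conversely, totality on the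
      sources leaves only the reversed pair, which monotonicity excludes.\<close>
    have "(u, v) \<in> source_order G \<longleftrightarrow> f u < f v"
    proof (cases "u = v")
      case True
      then show ?thesis using so'(3) by (simp add: irrefl_def)
    next
      case False
      then have "(u, v) \<in> source_order G \<or> (v, u) \<in> source_order G"
        using so'(4) uv by (auto simp: total_on_def)
      moreover have "u \<in> verts G" "v \<in> verts G" using uv S by blast+
      ultimately show ?thesis
        using less[of u v] less[of v u] by auto
    qed
    then show "(u, v) \<in> source_order G \<longleftrightarrow> (f u, f v) \<in> source_order (increasing_doag n l)"
      using uv S source_iff by (simp add: subset_iff)
  qed
  with l show ?thesis by (rule that)
qed

subsection \<open>Isomorphism classes\<close>

lemma card_edges_increasing_doag:
  assumes "l \<in> out_lists n"
  shows "card (edges (increasing_doag n l)) = (\<Sum>i<n. length (l i))"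
proof -
  have "set (l i) \<inter> set (l j) = {}" if "i < n" "j < n" "i \<noteq> j" for i j
    using out_listsD(2)[OF assms that(1)] out_listsD(2)[OF assms that(2)] that(3) by auto
  then have "card (\<Union>i<n. set (l i)) = (\<Sum>i<n. card (set (l i)))"
    by (intro card_UN_disjoint) auto
  also have "\<dots> = (\<Sum>i<n. length (l i))"
    by (intro sum.cong refl distinct_card out_listsD(1)[OF assms]) simp
  finally show ?thesis by simp
qed

lemma length_out_list_le:
  assumes "l \<in> out_lists n" "i < n"
  shows "length (l i) \<le> n - Suc i"
proof -
  have "card (set (l i)) \<le> card ({i} \<times> {i<..<n})"
    by (intro card_mono out_listsD(2)[OF assms]) simp
  then show ?thesis
    using distinct_card[OF out_listsD(1)[OF assms]] by (simp add: card_cartesian_product)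
qed

text \<open>Pairs are sorted by their smaller element, which matches the bound
  \<open>n - Suc i\<close> on the out-degree of vertex \<open>i\<close>.\<close>

lemma choose_two_eq_sum: "(n choose 2) = (\<Sum>i<n. n - Suc i)"
proof (induction n)
  case (Suc n)
  have "(\<Sum>i<Suc n. Suc n - Suc i) = n + (\<Sum>i<n. n - Suc i)"
    by (subst sum.lessThan_Suc_shift) simp
  then show ?case using Suc by (simp add: numeral_2_eq_2)
qed simp

abbreviation doag_class :: "nat \<Rightarrow> (nat \<Rightarrow> (nat \<times> nat) list) \<Rightarrow> nat doag set" where
  "doag_class n l \<equiv> doag_equality n `` {increasing_doag n l}"

text \<open>Every class has an increasingly numbered member. It may have several: a single source
  with two childless successors can be numbered in two ways. Sums of nonnegative terms over lists
  therefore only dominate those over classes.\<close>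

lemma doag_classes_subset: "doag_classes n \<subseteq> doag_class n ` out_lists n"
proof
  fix C assume "C \<in> doag_classes n"
  then obtain G where G: "G \<in> doags_on n" "C = doag_equality n `` {G}"
    by (auto simp: doag_classes_def elim: quotientE)
  obtain l f where l: "l \<in> out_lists n" "doag_iso f G (increasing_doag n l)"
    by (rule doag_iso_increasing_doag[OF G(1)])
  then have "(G, increasing_doag n l) \<in> doag_equality n"
    using G(1) increasing_doag_in_doags_on[OF l(1)] by (auto simp: doag_equality_def)
  then have "C = doag_class n l"
    using equiv_class_eq[OF equiv_doag_equality] G(2) by blast
  then show "C \<in> doag_class n ` out_lists n" using l(1) by blast
qed

lemma doag_class_in_doag_classes:
  assumes "l \<in> out_lists n"
  shows "doag_class n l \<in> doag_classes n"
  unfolding doag_classes_def by (intro quotientI increasing_doag_in_doags_on assms)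

text \<open>Isomorphic DOAGs have equally many edges, so the count can be read off the numbered
  representative.\<close>

lemma class_edge_count_doag_class:
  assumes "l \<in> out_lists n"
  shows "class_edge_count (doag_class n l) = (\<Sum>i<n. length (l i))"
proof -
  let ?G = "increasing_doag n l"
  have "?G \<in> doag_class n l"
    using equiv_class_self[OF equiv_doag_equality increasing_doag_in_doags_on[OF assms]] .
  moreover have "card (edges H) = card (edges ?G)" if "H \<in> doag_class n l" for H
    using that doag_iso_card_edges by (auto simp: doag_equality_def doags_on_def simp del: increasing_doag_simps)
  ultimately have "class_edge_count (doag_class n l) = card (edges ?G)"
    unfolding class_edge_count_def by (intro the_elem_image_unique) blast+
  then show ?thesis
    using card_edges_increasing_doag[OF assms] by simp
qed

lemma finite_distinct_lists:
  assumes "finite A"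
  shows "finite {xs. distinct xs \<and> set xs \<subseteq> A}"
  using finite_subset_distinct[OF assms] by (simp add: conj_commute)

lemma finite_out_lists: "finite (out_lists n)"
  unfolding out_lists_def by (intro finite_PiE finite_distinct_lists) simp_all

lemma finite_doag_classes: "finite (doag_classes n)"
  by (rule finite_subset[OF doag_classes_subset]) (simp add: finite_out_lists)

section \<open>Transitive tournaments and the lower bound on the number of classes\<close>

lemma full_out_lists_subset: "full_out_lists n \<subseteq> out_lists n"
  unfolding full_out_lists_def out_lists_def
  by (intro PiE_mono) (auto simp: permutations_of_set_def)

lemma card_full_out_lists: "card (full_out_lists n) = (\<Prod>i<n. fact (n - Suc i))"
  unfolding full_out_lists_def by (simp add: card_PiE card_cartesian_product)

text \<open>Rigidity: in a full DOAG the edge relation is \<open><\<close> on \<open>{..<n}\<close>,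
  so an isomorphism between two of them is increasing and hence the identity. It preserves
  out-orders, and these determine the lists.\<close>

lemma inj_on_doag_class: "inj_on (doag_class n) (full_out_lists n)"
proof (rule inj_onI)
  fix l l' assume l: "l \<in> full_out_lists n" and l': "l' \<in> full_out_lists n"
    and eq: "doag_class n l = doag_class n l'"
  let ?G = "increasing_doag n l" and ?H = "increasing_doag n l'"
  have set_full: "set (k i) = {i} \<times> {i<..<n}" if "k \<in> full_out_lists n" "i < n" for k i
    using that by (auto simp: full_out_lists_def PiE_def Pi_def permutations_of_set_def)
  have out: "l \<in> out_lists n" "l' \<in> out_lists n"
    using l l' full_out_lists_subset by blast+
  have edge_iff: "(u, v) \<in> edges (increasing_doag n k) \<longleftrightarrow> u < v"
    if "k \<in> full_out_lists n" "u < n" "v < n" for k u v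
    using that set_full[OF that(1)] by auto
  have "(?G, ?H) \<in> doag_equality n"
    using eq_equiv_class[OF eq equiv_doag_equality] increasing_doag_in_doags_on[OF out(2)] by blast
  then obtain f where f: "doag_iso f ?G ?H" by (auto simp: doag_equality_def)
  then have bij: "bij_betw f {..<n} {..<n}" by (simp add: doag_iso_def)
  have fn: "f v < n" if "v < n" for v
    using bij_betwE[OF bij] that by simp
  have mono: "f u < f v \<longleftrightarrow> u < v" if uv: "u < n" "v < n" for u v
  proof -
    have "(u, v) \<in> edges ?G \<longleftrightarrow> (f u, f v) \<in> edges ?H"
      using f uv unfolding doag_iso_def by simp
    then show ?thesis
      using edge_iff[OF l uv] edge_iff[OF l' fn[OF uv(1)] fn[OF uv(2)]] by blast
  qed
  \<comment> \<open>An increasing bijection maps the numbers below \<open>v\<close> onto those below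
    \<open>f v\<close>; comparing cardinalities gives the equality.\<close>
  have id: "f v = v" if v: "v < n" for v
  proof -
    have "f ` {..<v} = {..<f v}"
    proof (intro equalityI subsetI)
      fix w assume "w \<in> {..<f v}"
      then have w: "w < f v" "w \<in> f ` {..<n}"
        using fn[OF v] bij by (auto simp: bij_betw_def)
      then obtain u where "u < n" "w = f u" by blast
      then show "w \<in> f ` {..<v}" using w(1) mono[OF _ v] by auto
    next
      fix w assume "w \<in> f ` {..<v}"
      then show "w \<in> {..<f v}" using mono[OF _ v] v by auto
    qed
    moreover have "inj_on f {..<v}"
      using v by (intro inj_on_subset[OF bij_betw_imp_inj_on[OF bij]]) auto
    ultimately show ?thesis using card_image[of f "{..<v}"] by simp
  qed
  show "l = l'"
  proof (rule PiE_ext[OF l[unfolded full_out_lists_def] l'[unfolded full_out_lists_def]])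
    fix i assume "i \<in> {..<n}"
    then have i: "i < n" by simp
    note S = set_full[OF l i] set_full[OF l' i]
    have mid: "map_prod f f e = e" if "e \<in> {i} \<times> {i<..<n}" for e
      using that id i by auto
    have "\<forall>d\<in>{i} \<times> {i<..<n}. \<forall>e\<in>{i} \<times> {i<..<n}.
        (d, e) \<in> list_order (l i) \<longleftrightarrow> (map_prod f f d, map_prod f f e) \<in> list_order (l' (f i))"
      using f i id[OF i] out_edges_increasing_doag[OF out(1) i] S
      unfolding doag_iso_def by auto
    then have "(d, e) \<in> list_order (l i) \<longleftrightarrow> (d, e) \<in> list_order (l' i)"
      if "d \<in> {i} \<times> {i<..<n}" "e \<in> {i} \<times> {i<..<n}" for d e
      using mid that id[OF i] by metis
    moreover have "list_order (l i) \<subseteq> ({i} \<times> {i<..<n}) \<times> ({i} \<times> {i<..<n})"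
        "list_order (l' i) \<subseteq> ({i} \<times> {i<..<n}) \<times> ({i} \<times> {i<..<n})"
      using list_order_subset[of "l i"] list_order_subset[of "l' i"] S by simp_all
    ultimately have "list_order (l i) = list_order (l' i)"
      by (intro equalityI subrelI) blast+
    then show "l i = l' i"
      using list_order_inject out_listsD(1)[OF out(1) i] out_listsD(1)[OF out(2) i] S by metis
  qed
qed

lemma card_doag_classes_ge: "(\<Prod>i<n. fact (n - Suc i)) \<le> card (doag_classes n)"
proof -
  have "doag_class n ` full_out_lists n \<subseteq> doag_classes n"
    using full_out_lists_subset doag_class_in_doag_classes by blast
  then show ?thesis
    using card_mono[OF finite_doag_classes] card_image[OF inj_on_doag_class] card_full_out_lists
    by metis
qed

subsection \<open>The exponential moment of the number of missing edges\<close>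

lemma exp_partial_sum_le:
  fixes x :: real
  assumes "0 \<le> x"
  shows "(\<Sum>k\<le>m. x ^ k / fact k) \<le> exp x"
proof -
  have "(\<lambda>k. x ^ k / fact k) sums exp x"
    using exp_converges[of x] by (simp add: field_simps)
  then have "summable (\<lambda>k. x ^ k / fact k)" "(\<Sum>k. x ^ k / fact k) = exp x"
    by (simp_all add: sums_iff)
  then show ?thesis
    using sum_le_suminf[of "\<lambda>k. x ^ k / fact k" "{..m}"] assms by simp
qed

text \<open>With \<open>m = card A\<close>, exactly \<open>m!/j!\<close> distinct lists omit
  \<open>j\<close> elements. Grouping by \<open>j\<close> gives \<open>m!\<close> times a partial
  sum of the exponential series, so the weights cost only the constant factor
  \<open>exp x\<close>.\<close>

lemma sum_distinct_lists_le:
  fixes x :: real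
  assumes "finite A" "0 \<le> x"
  shows "(\<Sum>xs | distinct xs \<and> set xs \<subseteq> A. x ^ (card A - length xs)) \<le> fact (card A) * exp x"
proof -
  let ?D = "{xs. distinct xs \<and> set xs \<subseteq> A}" and ?m = "card A"
  have fin: "finite ?D"
    by (rule finite_distinct_lists[OF assms(1)])
  have len: "length xs \<le> ?m" if "xs \<in> ?D" for xs
    using that card_mono[OF assms(1), of "set xs"] by (simp add: distinct_card)
  have card: "real (card {xs \<in> ?D. length xs = k}) = fact ?m / fact (?m - k)" if "k \<le> ?m" for k
  proof -
    have "card {xs \<in> ?D. length xs = k} = \<Prod>{?m - k + 1..?m}"
      using card_lists_distinct_length_eq[OF assms(1) that] by (simp add: conj_ac)
    also have "\<dots> = fact ?m div fact (?m - k)"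
      using fact_div_fact[of "?m - k" ?m] by simp
    finally show ?thesis
      by (simp add: real_of_nat_div fact_dvd)
  qed
  have "(\<Sum>xs\<in>?D. x ^ (?m - length xs)) =
      (\<Sum>k\<le>?m. \<Sum>xs\<in>{xs \<in> ?D. length xs = k}. x ^ (?m - length xs))"
    using fin len by (intro sum.group[symmetric]) auto
  also have "\<dots> = (\<Sum>k\<le>?m. fact ?m * (x ^ (?m - k) / fact (?m - k)))"
  proof (intro sum.cong refl)
    fix k assume "k \<in> {..?m}"
    have "(\<Sum>xs\<in>{xs \<in> ?D. length xs = k}. x ^ (?m - length xs)) =
        real (card {xs \<in> ?D. length xs = k}) * x ^ (?m - k)"
      by simp
    then show "(\<Sum>xs\<in>{xs \<in> ?D. length xs = k}. x ^ (?m - length xs)) =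
        fact ?m * (x ^ (?m - k) / fact (?m - k))"
      using card[of k] \<open>k \<in> {..?m}\<close> by simp
  qed
  also have "\<dots> = fact ?m * (\<Sum>k\<le>?m. x ^ k / fact k)"
    unfolding sum_distrib_left[symmetric]
    by (intro arg_cong2[where f = times] refl
        sum.reindex_bij_witness[of _ "\<lambda>k. ?m - k" "\<lambda>k. ?m - k"]) auto
  also have "\<dots> \<le> fact ?m * exp x"
    by (intro mult_left_mono exp_partial_sum_le assms(2)) simp
  finally show ?thesis .
qed

definition missing :: "nat \<Rightarrow> nat doag set \<Rightarrow> real" where
  "missing n C = real (n choose 2) - real (class_edge_count C)"

text \<open>The missing pairs are counted at their smaller vertex. By
  \<open>length_out_list_le\<close> no natural-number subtraction is truncated.\<close>

lemma missing_doag_class: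
  assumes "l \<in> out_lists n"
  shows "missing n (doag_class n l) = real (\<Sum>i<n. n - Suc i - length (l i))"
proof -
  have "(\<Sum>i<n. n - Suc i - length (l i)) = (\<Sum>i<n. n - Suc i) - (\<Sum>i<n. length (l i))"
    by (rule sum_subtractf_nat) (use length_out_list_le[OF assms] in auto)
  moreover have "(\<Sum>i<n. length (l i)) \<le> (\<Sum>i<n. n - Suc i)"
    by (rule sum_mono) (use length_out_list_le[OF assms] in auto)
  ultimately show ?thesis
    by (simp add: missing_def class_edge_count_doag_class[OF assms] choose_two_eq_sum of_nat_diff
        del: of_nat_sum)
qed

lemma missing_nonneg:
  assumes "C \<in> doag_classes n"
  shows "0 \<le> missing n C"
proof -
  obtain l where "l \<in> out_lists n" "C = doag_class n l"
    using assms doag_classes_subset by blast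
  then show ?thesis by (simp add: missing_doag_class del: of_nat_sum)
qed

text \<open>The number of missing edges is a sum over the vertices, so its exponential is a product
  and the sum over lists factors. Each factor costs \<open>exp (exp 1)\<close> besides a
  factorial.\<close>

lemma sum_exp_missing_le:
  "(\<Sum>C\<in>doag_classes n. exp (missing n C)) \<le> real (card (doag_classes n)) * exp (exp 1 * real n)"
proof -
  define D where "D = (\<lambda>i. {xs. distinct xs \<and> set xs \<subseteq> {i} \<times> {i<..<n}})"
  have out: "out_lists n = PiE {..<n} D" by (simp add: out_lists_def D_def)
  have finD: "finite (D i)" for i
    unfolding D_def by (simp add: finite_distinct_lists)
  have "(\<Sum>C\<in>doag_classes n. exp (missing n C)) \<le>
      (\<Sum>C\<in>doag_class n ` out_lists n. exp (missing n C))"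
    by (intro sum_mono2 doag_classes_subset) (simp_all add: finite_out_lists)
  also have "\<dots> \<le> (\<Sum>l\<in>out_lists n. exp (missing n (doag_class n l)))"
    using sum_image_le[OF finite_out_lists, where g = "\<lambda>C. exp (missing n C)" and f = "doag_class n"]
    by (simp add: comp_def)
  also have "\<dots> = (\<Sum>l\<in>out_lists n. \<Prod>i<n. exp 1 ^ (n - Suc i - length (l i)))"
    by (intro sum.cong refl)
      (simp add: missing_doag_class exp_sum flip: exp_of_nat_mult)
  also have "\<dots> = (\<Prod>i<n. \<Sum>xs\<in>D i. exp 1 ^ (n - Suc i - length xs))"
    unfolding out by (rule prod_sum_PiE[symmetric]) (simp_all add: finD)
  also have "\<dots> \<le> (\<Prod>i<n. fact (n - Suc i) * exp (exp 1))"
  proof (intro prod_mono conjI sum_nonneg)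
    fix i
    show "(\<Sum>xs\<in>D i. exp 1 ^ (n - Suc i - length xs)) \<le> fact (n - Suc i) * exp (exp (1 :: real))"
      using sum_distinct_lists_le[of "{i} \<times> {i<..<n}" "exp 1"]
      by (simp add: D_def card_cartesian_product)
  qed simp
  also have "\<dots> = real (\<Prod>i<n. fact (n - Suc i)) * exp (exp 1 * real n)"
    by (simp add: prod.distrib exp_of_nat2_mult)
  \<comment> \<open>The product of the factorials is the number of full lists, hence at most the
    number of classes.\<close>
  also have "\<dots> \<le> real (card (doag_classes n)) * exp (exp 1 * real n)"
    by (intro mult_right_mono of_nat_mono card_doag_classes_ge) simp
  finally show ?thesis .
qed

text \<open>The upper bound is Jensen's inequality for \<open>exp\<close>, carried out by averaging
  the tangent inequality \<open>t + 1 \<le> exp t\<close>.\<close>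

lemma expected_missing_bounds:
  "0 \<le> real (n choose 2) - expected_edges n" "real (n choose 2) - expected_edges n \<le> exp 1 * real n"
proof -
  let ?K = "doag_classes n" and ?c = "exp 1 * real n"
  have pos: "0 < card ?K"
  proof -
    have "0 < (\<Prod>i<n. fact (n - Suc i) :: nat)" by (intro prod_pos) simp
    then show ?thesis using card_doag_classes_ge[of n] by linarith
  qed
  then have "?K \<noteq> {}" by auto
  then have "expected_edges n = (\<Sum>C\<in>?K. real (class_edge_count C)) / real (card ?K)"
    unfolding expected_edges_def by (rule integral_pmf_of_set[OF _ finite_doag_classes])
  then have eq: "real (n choose 2) - expected_edges n = (\<Sum>C\<in>?K. missing n C) / real (card ?K)"
    using pos by (simp add: missing_def sum_subtractf field_simps)
  show "0 \<le> real (n choose 2) - expected_edges n"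
    unfolding eq by (intro divide_nonneg_nonneg sum_nonneg missing_nonneg) simp_all
  \<comment> \<open>The tangent inequality is taken at \<open>t = missing n C - ?c\<close>: the
    moment bound makes the exponential terms average to at most 1, which cancels the
    \<open>- 1\<close>.\<close>
  have "(\<Sum>C\<in>?K. missing n C) \<le> (\<Sum>C\<in>?K. (?c - 1) + exp (missing n C) * exp (- ?c))"
  proof (rule sum_mono)
    fix C
    show "missing n C \<le> (?c - 1) + exp (missing n C) * exp (- ?c)"
      using exp_ge_add_one_self[of "missing n C - ?c"]
      by (simp add: exp_diff exp_minus divide_inverse)
  qed
  also have "\<dots> = real (card ?K) * (?c - 1) + (\<Sum>C\<in>?K. exp (missing n C)) * exp (- ?c)"
    by (simp add: sum.distrib sum_distrib_right)
  also have "\<dots> \<le> real (card ?K) * (?c - 1) + (real (card ?K) * exp ?c) * exp (- ?c)"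
    by (intro add_left_mono mult_right_mono sum_exp_missing_le) simp
  also have "\<dots> = real (card ?K) * ?c"
    by (simp add: exp_minus algebra_simps)
  finally show "real (n choose 2) - expected_edges n \<le> ?c"
    unfolding eq using pos by (simp add: pos_divide_le_eq mult.commute)
qed

theorem theorem5p7:
  "(\<lambda>n. real (n choose 2) - expected_edges n) \<in> O(\<lambda>n. real n)"
  \<comment> \<open>The lower bound 0 removes the norm, and the estimate with constant
    \<open>exp 1\<close> holds for every \<open>n\<close>.\<close>
  by (rule bigoI[where c = "exp 1"]) (use expected_missing_bounds in simp)

end
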